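(* Let $1\le r<\infty$, $1\le\sigma<\infty$, let $\rho:\mathbb{R}^d\to[0,+\infty)$ be a convex penalty function, and suppose that for any $\boldsymbol\beta\in\mathbb{R}^d$ there exists a subgradient $\boldsymbol\beta^*\in\partial\rho(\boldsymbol\beta)$ such that $$\left|\boldsymbol\gamma^\top\left(\boldsymbol\beta^*-\frac{\boldsymbol\beta}{\boldsymbol\beta^\top\boldsymbol\beta}\,\rho^*(\boldsymbol\beta^* )\right)\right|\le\rho(\boldsymbol\gamma)\qquad\text{for all }\boldsymbol\gamma\in\mathbb{R}^d. \qquad (\ast)$$ Let $\delta\ge0$ and $\mathbb{P}\in\mathcal{P}_r(\mathbb{R}^{d+1})$. Then for each $\boldsymbol\beta\in\mathbb{R}^d$ the supremum $$\sup_{\widetilde{\mathbb{P}}\in B_\delta(\mathbb{P})}\mathbb{E}_{\widetilde{\mathbb{P}}}\left[|Y-\mathbf{X}^\top\boldsymbol\beta|^r\right]$$ is attained for the distribution $\mathbb{P}^*_{\boldsymbol\beta}$ corresponding to the random vector $(\widetilde{\mathbf{X}},\widetilde{Y})$ defined as $$\widetilde{\mathbf{X}}=\mathbf{X}-e\left(\boldsymbol\beta^*-\frac{\boldsymbol\beta}{\boldsymbol\beta^\top\boldsymbol\beta}\,\rho^*(\boldsymbol\beta^* )\right),\qquad\widetilde{Y}=Y+\sigma e,$$ where $$e:=\frac{\delta\,(Y-\mathbf{X}^\top\boldsymbol\beta)}{\left(\mathbb{E}_{\mathbb{P}}[|Y-\mathbf{X}^\top\boldsymbol\beta|^r]\right)^{1/r}},\qquad(\mathbf{X},Y)\sim\mathbb{P},$$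 and $\boldsymbol\beta^*\in\partial\rho(\boldsymbol\beta)$ is a subgradient satisfying $(\ast)$.
   Context: $\mathcal{P}_r(\mathbb{R}^{d+1})$ is the set of Borel probability measures on $\mathbb{R}^{d+1}$ with finite $r$-th moment. Points of $\mathbb{R}^{d+1}$ are written $(\mathbf{x},y)$ with $\mathbf{x}\in\mathbb{R}^d$, $y\in\mathbb{R}$; $\mathbb{E}_{\mathbb{Q}}$ denotes expectation when $(\mathbf{X},Y)\sim\mathbb{Q}$. $\Pi(\mathbb{P},\widetilde{\mathbb{P}})$ is the set of couplings, i.e. joint laws of $((\mathbf{X},Y),(\widetilde{\mathbf{X}},\widetilde{Y}))$ with marginals $\mathbb{P}$ and $\widetilde{\mathbb{P}}$. The $\rho$-max-sliced Wasserstein distance is $$\widehat{\mathcal{W}}_{r,\rho,\sigma}(\mathbb{P},\widetilde{\mathbb{P}})=\sup_{\boldsymbol\gamma\in\mathbb{R}^d}\ \inf_{\pi\in\Pi(\mathbb{P},\widetilde{\mathbb{P}})}\frac{1}{\sigma+\rho(\boldsymbol\gamma)}\left(\mathbb{E}_\pi\left[\left|(Y-\mathbf{X}^\top\boldsymbol\gamma)-(\widetilde{Y}-\widetilde{\mathbf{X}}^\top\boldsymbol\gamma)\right|^r\right]\right)^{1/r},$$ and $B_\delta(\mathbb{P})=\{\mathbb{Q}\in\mathcal{P}_r(\mathbb{R}^{d+1}):\widehat{\mathcal{W}}_{r,\rho,\sigma}(\mathbb{Q},\mathbb{P})\le\delta\}$. $\rho^*(\mathbf{b})=\sup_{\mathbf{x}\in\mathbb{R}^d}\{\mathbf{b}^\top\mathbf{x}-\rho(\mathbf{x})\}$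 is the convex conjugate and $\partial\rho(\boldsymbol\beta)=\{\mathbf{b}:\rho(\mathbf{x})\ge\rho(\boldsymbol\beta)+\mathbf{b}^\top(\mathbf{x}-\boldsymbol\beta)\ \forall\mathbf{x}\in\mathbb{R}^d\}$ is the subdifferential of $\rho$ at $\boldsymbol\beta$.
   Formalization: The case δ > 0 with E_P[|Y − X'β|^r] = 0, where e is 0/0 and the distribution is undefined, is excluded; for δ = 0, e is taken as 0, and at β = 0 the term β/(β'β) is read as 0. *)

theory Defs
  imports "HOL-Probability.Probability"
begin

type_synonym 'n data = "(real^'n) \<times> real"

definition moment_measures :: "real \<Rightarrow> ('n::finite) data measure set" where
  "moment_measures r =
     {P. prob_space P \<and> sets P = sets borel \<and> integrable P (\<lambda>z. norm z powr r)}"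

definition couplings ::
  "('n::finite) data measure \<Rightarrow> 'n data measure \<Rightarrow> ('n data \<times> 'n data) measure set" where
  "couplings P Q =
     {M. prob_space M \<and> sets M = sets borel \<and> distr M borel fst = P \<and> distr M borel snd = Q}"

definition residual :: "real^'n \<Rightarrow> ('n::finite) data \<Rightarrow> real" where
  "residual \<gamma> z = snd z - fst z \<bullet> \<gamma>"

(* Extended-real valued because the supremum over all \<gamma> may be infinite.  For P and Q with
   finite r-th moment the integral below is finite for every coupling, and the set of
   couplings contains the product measure. *)
definition max_sliced_wasserstein ::
  "real \<Rightarrow> (real^'n \<Rightarrow> real) \<Rightarrow> real \<Rightarrow> ('n::finite) data measure \<Rightarrow> 'n data measure \<Rightarrow> ereal" where
  "max_sliced_wasserstein r \<rho> \<sigma> P Q =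
     (SUP \<gamma>. INF M\<in>couplings P Q.
        ereal (1 / (\<sigma> + \<rho> \<gamma>) *
          (\<integral>w. \<bar>residual \<gamma> (fst w) - residual \<gamma> (snd w)\<bar> powr r \<partial>M) powr (1 / r)))"

definition wasserstein_ball ::
  "real \<Rightarrow> (real^'n \<Rightarrow> real) \<Rightarrow> real \<Rightarrow> real \<Rightarrow> ('n::finite) data measure \<Rightarrow> 'n data measure set" where
  "wasserstein_ball r \<rho> \<sigma> \<delta> P =
     {Q \<in> moment_measures r. max_sliced_wasserstein r \<rho> \<sigma> Q P \<le> ereal \<delta>}"

definition convex_conjugate :: "(real^'n \<Rightarrow> real) \<Rightarrow> real^('n::finite) \<Rightarrow> ereal" where
  "convex_conjugate \<rho> b = (SUP x. ereal (b \<bullet> x - \<rho> x))"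

definition subdifferential :: "(real^'n \<Rightarrow> real) \<Rightarrow> real^('n::finite) \<Rightarrow> (real^'n) set" where
  "subdifferential \<rho> \<beta> = {b. \<forall>x. \<rho> x \<ge> \<rho> \<beta> + b \<bullet> (x - \<beta>)}"

(* The conjugate is finite at every subgradient b (its value there is b \<bullet> \<beta> - \<rho> \<beta>), so
   real_of_ereal loses nothing.  At \<beta> = 0 the second summand is 0 by division by zero;
   if admissible subgradients (below) exist at all \<beta> then \<rho> is absolutely homogeneous, so the
   conjugate vanishes at every subgradient and this convention has no effect. *)
definition shift_direction :: "(real^'n \<Rightarrow> real) \<Rightarrow> real^'n \<Rightarrow> real^'n \<Rightarrow> real^('n::finite)" where
  "shift_direction \<rho> \<beta> b =
     b - real_of_ereal (convex_conjugate \<rho> b) *\<^sub>R (\<beta> /\<^sub>R (\<beta> \<bullet> \<beta>))"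

definition admissible_subgradient :: "(real^'n \<Rightarrow> real) \<Rightarrow> real^'n \<Rightarrow> real^('n::finite) \<Rightarrow> bool" where
  "admissible_subgradient \<rho> \<beta> b \<longleftrightarrow>
     b \<in> subdifferential \<rho> \<beta> \<and> (\<forall>\<gamma>. \<bar>\<gamma> \<bullet> shift_direction \<rho> \<beta> b\<bar> \<le> \<rho> \<gamma>)"

definition expected_loss :: "real \<Rightarrow> real^'n \<Rightarrow> ('n::finite) data measure \<Rightarrow> real" where
  "expected_loss r \<beta> P = (\<integral>z. \<bar>residual \<beta> z\<bar> powr r \<partial>P)"

(* Meaningful when the expected loss is nonzero; for \<delta> = 0 it is identically 0. *)
definition perturbation ::
  "real \<Rightarrow> real \<Rightarrow> real^'n \<Rightarrow> ('n::finite) data measure \<Rightarrow> 'n data \<Rightarrow> real" where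
  "perturbation r \<delta> \<beta> P z = \<delta> * residual \<beta> z / (expected_loss r \<beta> P powr (1 / r))"

definition worst_case_distribution ::
  "real \<Rightarrow> (real^'n \<Rightarrow> real) \<Rightarrow> real \<Rightarrow> real \<Rightarrow> real^'n \<Rightarrow> real^'n \<Rightarrow>
     ('n::finite) data measure \<Rightarrow> 'n data measure" where
  "worst_case_distribution r \<rho> \<sigma> \<delta> \<beta> b P =
     distr P borel (\<lambda>z. (fst z - perturbation r \<delta> \<beta> P z *\<^sub>R shift_direction \<rho> \<beta> b,
                         snd z + \<sigma> * perturbation r \<delta> \<beta> P z))"

end

theory Submission
  imports Defs
begin

text \<open>
  Write \<open>v\<close> for the shift direction, \<open>A = (E |residual \<beta>|^r)^(1/r)\<close> under the centre \<open>P\<close>, and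
  \<open>K = \<sigma> + \<rho> \<beta>\<close>. Both sides of the claim equal \<open>(A + \<delta> K)^r\<close>.

  No distribution in the ball does better: testing the max-sliced distance in the single direction
  \<open>\<beta>\<close> gives couplings with \<open>P\<close> whose residuals differ by little more than \<open>\<delta> K\<close> in \<open>L^r\<close>, and
  Minkowski's inequality turns this into a bound on the loss (lemma \<open>expected_loss_le_in_ball\<close>).

  The bound is reached because of two properties of \<open>v\<close>. The point
  \<open>(X - e v, Y + \<sigma> e)\<close> has residual \<open>residual \<gamma> (X, Y) + e (\<sigma> + \<gamma> \<bullet> v)\<close> in every direction \<open>\<gamma>\<close>.
  Admissibility says \<open>|\<gamma> \<bullet> v| \<le> \<rho> \<gamma>\<close>, so the coupling of each point with its image moves the
  residual by at most \<open>|e| (\<sigma> + \<rho> \<gamma>)\<close>; as \<open>e\<close> has \<open>L^r\<close> norm at most \<open>\<delta>\<close>, the image stays in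
  the ball (lemma \<open>max_sliced_wasserstein_push_le\<close>). On the other hand \<open>\<beta> \<bullet> v = \<rho> \<beta>\<close>, by the
  equality case of the Fenchel inequality, and \<open>e\<close> is a nonnegative multiple of \<open>residual \<beta>\<close>, so in
  direction \<open>\<beta>\<close> the residual is multiplied by the constant \<open>1 + \<delta> K / A\<close>, which is the equality
  case of Minkowski's inequality (lemma \<open>expected_loss_push\<close>).

  The identity \<open>\<beta> \<bullet> v = \<rho> \<beta>\<close> needs an argument at \<open>\<beta> = 0\<close>, where it says \<open>\<rho> 0 = 0\<close>:
  admissible subgradients at all points force \<open>\<rho>\<close> to be positively homogeneous away from the
  origin, and convexity extends this to the origin (lemma \<open>penalty_zero\<close>).
\<close>

section \<open>Subgradients and the shift direction\<close>

text \<open>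
  A subgradient at \<open>\<beta>\<close> is exactly a slope for which the supremum in the conjugate is reached at
  \<open>\<beta>\<close>.
\<close>

lemma convex_conjugate_subgradient:
  assumes "b \<in> subdifferential \<rho> \<beta>"
  shows "convex_conjugate \<rho> b = ereal (b \<bullet> \<beta> - \<rho> \<beta>)"
  unfolding convex_conjugate_def
proof (rule antisym)
  show "(SUP x. ereal (b \<bullet> x - \<rho> x)) \<le> ereal (b \<bullet> \<beta> - \<rho> \<beta>)"
  proof (rule SUP_least)
    fix x
    have "\<rho> x \<ge> \<rho> \<beta> + b \<bullet> (x - \<beta>)"
      using assms by (simp add: subdifferential_def)
    then show "ereal (b \<bullet> x - \<rho> x) \<le> ereal (b \<bullet> \<beta> - \<rho> \<beta>)"
      by (simp add: inner_diff_right)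
  qed
qed (rule SUP_upper, simp)

text \<open>
  The correction by a multiple of \<open>\<beta>\<close> lowers \<open>\<beta> \<bullet> b\<close> by the value of the conjugate, which
  is \<open>\<beta> \<bullet> b - \<rho> \<beta>\<close>.
\<close>

lemma inner_shift_direction_nonzero:
  assumes "b \<in> subdifferential \<rho> \<beta>" and "\<beta> \<noteq> 0"
  shows "\<beta> \<bullet> shift_direction \<rho> \<beta> b = \<rho> \<beta>"
  using assms
  by (simp add: shift_direction_def convex_conjugate_subgradient inner_diff_right inner_commute
      mult.assoc)

text \<open>
  Away from the origin \<open>\<rho> x\<close> is the largest value of \<open>|x \<bullet> v|\<close> over all admissible shift
  directions \<open>v\<close>: each of them is dominated by \<open>\<rho>\<close>, and the one at \<open>x\<close> reaches it. Such a
  maximum is homogeneous.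
\<close>

lemma penalty_scale:
  fixes \<rho> :: "real^'n::finite \<Rightarrow> real"
  assumes adm: "\<forall>\<beta>. \<exists>b. admissible_subgradient \<rho> \<beta> b" and "0 < t" and "x \<noteq> 0"
  shows "\<rho> (t *\<^sub>R x) = t * \<rho> x"
proof -
  have le: "s * \<rho> y \<le> \<rho> (s *\<^sub>R y)" if "0 < s" "y \<noteq> 0" for s y
  proof -
    obtain b where b: "admissible_subgradient \<rho> y b"
      using adm by blast
    let ?v = "shift_direction \<rho> y b"
    have "s * \<rho> y = (s *\<^sub>R y) \<bullet> ?v"
      using inner_shift_direction_nonzero[of b \<rho> y] b that
      by (simp add: admissible_subgradient_def)
    also have "\<dots> \<le> \<bar>(s *\<^sub>R y) \<bullet> ?v\<bar>"
      by (rule abs_ge_self)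
    also have "\<dots> \<le> \<rho> (s *\<^sub>R y)"
      using b by (simp only: admissible_subgradient_def)
    finally show ?thesis .
  qed
  have "inverse t * \<rho> (t *\<^sub>R x) \<le> \<rho> x"
    using le[of "inverse t" "t *\<^sub>R x"] assms by simp
  then have "\<rho> (t *\<^sub>R x) \<le> t * \<rho> x"
    using \<open>0 < t\<close> by (simp add: field_simps)
  then show ?thesis
    using le[of t x] assms by simp
qed

text \<open>
  By convexity \<open>\<rho> 0\<close> is at most the mean of \<open>\<rho>\<close> at \<open>t x\<close> and \<open>- t x\<close>, and by homogeneity
  this mean is \<open>t\<close> times a constant, which tends to zero with \<open>t\<close>.
\<close>

lemma penalty_zero:
  fixes \<rho> :: "real^'n::finite \<Rightarrow> real"
  assumes cvx: "convex_on UNIV \<rho>" and nonneg: "\<forall>x. 0 \<le> \<rho> x"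
    and adm: "\<forall>\<beta>. \<exists>b. admissible_subgradient \<rho> \<beta> b"
  shows "\<rho> 0 = 0"
proof -
  obtain x :: "real^'n" where x: "x \<noteq> 0"
    using axis_eq_0_iff[of _ "1::real"] by (metis zero_neq_one)
  let ?C = "\<rho> x + \<rho> (- x)"
  have "\<rho> 0 \<le> e" if "0 < e" for e
  proof -
    \<comment> \<open>The summand 1 keeps the denominator positive when \<open>\<rho>\<close> vanishes at \<open>x\<close> and \<open>- x\<close>.\<close>
    define t where "t = e / (1 + ?C)"
    have C: "0 \<le> ?C"
      using nonneg by (simp add: add_nonneg_nonneg)
    have t: "0 < t"
      using C \<open>0 < e\<close> by (simp add: t_def)
    have "\<rho> 0 = \<rho> ((1 - 1/2) *\<^sub>R (t *\<^sub>R x) + (1/2) *\<^sub>R (t *\<^sub>R (- x)))"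
      by simp
    also have "\<dots> \<le> (1 - 1/2) * \<rho> (t *\<^sub>R x) + (1/2) * \<rho> (t *\<^sub>R (- x))"
      by (rule convex_onD[OF cvx]) auto
    also have "\<dots> = t * ?C / 2"
      using penalty_scale[OF adm t x] penalty_scale[OF adm t, of "- x"] x
      by (simp add: algebra_simps add_divide_distrib)
    also have "\<dots> \<le> t * (1 + ?C)"
      using mult_nonneg_nonneg[of t ?C] C t by (simp add: distrib_left)
    also have "\<dots> = e"
      using C by (simp add: t_def)
    finally show ?thesis .
  qed
  then have "\<rho> 0 \<le> 0"
    using field_le_epsilon[of "\<rho> 0" 0] by simp
  with nonneg show ?thesis
    by (simp add: antisym)
qed

lemma inner_shift_direction:
  fixes \<rho> :: "real^'n::finite \<Rightarrow> real"
  assumes "convex_on UNIV \<rho>" and "\<forall>x. 0 \<le> \<rho> x"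
    and "\<forall>\<beta>. \<exists>b. admissible_subgradient \<rho> \<beta> b"
    and "b \<in> subdifferential \<rho> \<beta>"
  shows "\<beta> \<bullet> shift_direction \<rho> \<beta> b = \<rho> \<beta>"
  using inner_shift_direction_nonzero[of b \<rho> \<beta>] penalty_zero[of \<rho>] assms
  by (cases "\<beta> = 0") auto

section \<open>Minkowski's inequality\<close>

text \<open>
  The end point has to be added to the open half-line because residuals may vanish; there
  convexity comes down to \<open>t^r \<le> t\<close> for \<open>t\<close> in the unit interval.
\<close>

lemma convex_on_powr_nonneg:
  fixes r :: real
  assumes r: "1 \<le> r"
  shows "convex_on {0..} (\<lambda>x. x powr r)"
proof (rule convex_on_linorderI)
  fix t x y :: real
  assume t: "0 < t" "t < 1" and "x \<in> {0..}" and "y \<in> {0..}" and "x < y"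
  show "((1 - t) *\<^sub>R x + t *\<^sub>R y) powr r \<le> (1 - t) * x powr r + t * y powr r"
  proof (cases "x = 0")
    case True
    have "t powr r \<le> t powr 1"
      using r t by (intro powr_mono') auto
    then show ?thesis
      using True t r by (simp add: powr_mult mult_right_mono)
  next
    case False
    then show ?thesis
      using convex_onD[OF powr_convex[OF r], of t x y] t \<open>x \<in> {0..}\<close> \<open>x < y\<close> by simp
  qed
qed simp

text \<open>
  This is convexity of the power function at \<open>|a| / A\<close> and \<open>|b| / B\<close> with weights
  \<open>A / (A + B)\<close> and \<open>B / (A + B)\<close>, whose weighted mean is \<open>(|a| + |b|) / (A + B)\<close>. When \<open>A\<close>
  and \<open>B\<close> bound the \<open>L^r\<close> norms of two functions, integrating it gives Minkowski's
  inequality.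
\<close>

lemma powr_add_le_weighted:
  fixes a b :: real
  assumes r: "1 \<le> r" and "0 < A" and "0 < B"
  shows "\<bar>a + b\<bar> powr r \<le>
    (A + B) powr r * (A / (A + B) * (\<bar>a\<bar> powr r / A powr r) + B / (A + B) * (\<bar>b\<bar> powr r / B powr r))"
proof -
  define l where "l = B / (A + B)"
  have l: "0 \<le> l" "l \<le> 1" "1 - l = A / (A + B)"
    using assms by (auto simp: l_def field_simps)
  have "\<bar>a + b\<bar> powr r \<le> (\<bar>a\<bar> + \<bar>b\<bar>) powr r"
    using r by (intro powr_mono2) auto
  also have "\<bar>a\<bar> + \<bar>b\<bar> = (A + B) * ((1 - l) * (\<bar>a\<bar> / A) + l * (\<bar>b\<bar> / B))"
    unfolding l(3) using assms by (simp add: l_def distrib_left)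
  also have "\<dots> powr r = (A + B) powr r * ((1 - l) * (\<bar>a\<bar> / A) + l * (\<bar>b\<bar> / B)) powr r"
    by (intro powr_mult)
  also have "((1 - l) * (\<bar>a\<bar> / A) + l * (\<bar>b\<bar> / B)) powr r
      \<le> (1 - l) * (\<bar>a\<bar> / A) powr r + l * (\<bar>b\<bar> / B) powr r"
    using convex_onD[OF convex_on_powr_nonneg[OF r], of l "\<bar>a\<bar> / A" "\<bar>b\<bar> / B"] l assms by simp
  finally show ?thesis
    using assms unfolding l(3) by (simp add: l_def powr_divide mult_left_mono)
qed

lemma integrable_powr_add:
  fixes f g :: "'a \<Rightarrow> real"
  assumes r: "1 \<le> r"
    and [measurable]: "f \<in> borel_measurable M" "g \<in> borel_measurable M"
    and f: "integrable M (\<lambda>w. \<bar>f w\<bar> powr r)" and g: "integrable M (\<lambda>w. \<bar>g w\<bar> powr r)"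
  shows "integrable M (\<lambda>w. \<bar>f w + g w\<bar> powr r)"
proof (rule Bochner_Integration.integrable_bound)
  show "integrable M (\<lambda>w. 2 powr r * (1/2 * \<bar>f w\<bar> powr r + 1/2 * \<bar>g w\<bar> powr r))"
    using f g by auto
  show "AE w in M. norm (\<bar>f w + g w\<bar> powr r)
      \<le> norm (2 powr r * (1/2 * \<bar>f w\<bar> powr r + 1/2 * \<bar>g w\<bar> powr r))"
    using powr_add_le_weighted[OF r, of 1 1] by (intro AE_I2) simp
qed measurable

text \<open>
  The norms are replaced by positive upper bounds \<open>A\<close> and \<open>B\<close>, so that the weights of
  \<open>powr_add_le_weighted\<close> are defined even when a norm is zero.
\<close>

lemma Minkowski_powr:
  fixes f g :: "'a \<Rightarrow> real"
  assumes r: "1 \<le> r" and A: "0 < A" and B: "0 < B"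
    and meas: "f \<in> borel_measurable M" "g \<in> borel_measurable M"
    and f: "integrable M (\<lambda>w. \<bar>f w\<bar> powr r)" and g: "integrable M (\<lambda>w. \<bar>g w\<bar> powr r)"
    and fA: "(\<integral>w. \<bar>f w\<bar> powr r \<partial>M) \<le> A powr r" and gB: "(\<integral>w. \<bar>g w\<bar> powr r \<partial>M) \<le> B powr r"
  shows "(\<integral>w. \<bar>f w + g w\<bar> powr r \<partial>M) \<le> (A + B) powr r"
proof -
  have "(\<integral>w. \<bar>f w + g w\<bar> powr r \<partial>M) \<le>
     (\<integral>w. (A + B) powr r * (A / (A + B) * (\<bar>f w\<bar> powr r / A powr r)
         + B / (A + B) * (\<bar>g w\<bar> powr r / B powr r)) \<partial>M)"
    using f g by (intro integral_mono integrable_powr_add[OF r meas f g] powr_add_le_weighted[OF r A B]) auto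
  also have "\<dots> = (A + B) powr r * (A / (A + B) * ((\<integral>w. \<bar>f w\<bar> powr r \<partial>M) / A powr r)
         + B / (A + B) * ((\<integral>w. \<bar>g w\<bar> powr r \<partial>M) / B powr r))"
    using f g by simp
  also have "\<dots> \<le> (A + B) powr r * (A / (A + B) * 1 + B / (A + B) * 1)"
    using A B fA gB by (intro mult_left_mono add_mono) auto
  also have "A / (A + B) * 1 + B / (A + B) * 1 = 1"
    using A B by (metis add_divide_distrib add_pos_pos divide_self less_irrefl mult.right_neutral)
  finally show ?thesis by simp
qed

section \<open>Moments of the residual\<close>

lemma moment_measuresD:
  assumes "P \<in> moment_measures r"
  shows "prob_space P" "sets P = sets borel" "integrable P (\<lambda>z. norm z powr r)"
  using assms by (auto simp: moment_measures_def)

lemma linear_residual: "linear (residual \<gamma>)"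
  by (rule linearI) (simp_all add: residual_def inner_add_left algebra_simps)

lemma borel_measurable_linear:
  fixes T :: "'a::euclidean_space \<Rightarrow> 'b::euclidean_space"
  assumes "linear T"
  shows "T \<in> borel_measurable borel"
  using assms
  by (intro borel_measurable_continuous_onI linear_continuous_on)
    (simp add: linear_conv_bounded_linear)

lemma borel_measurable_residual [measurable]: "residual \<gamma> \<in> borel_measurable borel"
  by (rule borel_measurable_linear[OF linear_residual])

lemma integrable_linear_powr:
  fixes P :: "'n::finite data measure" and T :: "'n data \<Rightarrow> 'b::euclidean_space"
  assumes P: "P \<in> moment_measures r" and "0 \<le> r" and T: "linear T"
  shows "integrable P (\<lambda>z. norm (T z) powr r)"
proof -
  have [measurable_cong]: "sets P = sets borel"
    using moment_measuresD[OF P] by simp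
  have [measurable]: "T \<in> borel_measurable borel"
    by (rule borel_measurable_linear[OF T])
  obtain C where "0 < C" and C: "\<And>z. norm (T z) \<le> C * norm z"
    using linear_bounded_pos[OF T] by blast
  show ?thesis
  proof (rule Bochner_Integration.integrable_bound)
    show "integrable P (\<lambda>z. C powr r * norm z powr r)"
      using moment_measuresD[OF P] by auto
    show "AE z in P. norm (norm (T z) powr r) \<le> norm (C powr r * norm z powr r)"
      using C \<open>0 \<le> r\<close> \<open>0 < C\<close>
      by (intro AE_I2) (simp add: powr_mult[symmetric] powr_mono2)
  qed measurable
qed

lemma integrable_residual_powr:
  assumes "P \<in> moment_measures r" and "0 \<le> r"
  shows "integrable P (\<lambda>z. \<bar>residual \<gamma> z\<bar> powr r)"
  using integrable_linear_powr[OF assms linear_residual] by simp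

lemma expected_loss_nonneg: "0 \<le> expected_loss r \<beta> P"
  by (simp add: expected_loss_def)

section \<open>The upper bound over the ball\<close>

lemma coupling_residual_moments:
  assumes "M \<in> couplings Q P" and Q: "Q \<in> moment_measures r" and P: "P \<in> moment_measures r"
    and "0 \<le> r"
  shows "integrable M (\<lambda>w. \<bar>residual \<gamma> (fst w)\<bar> powr r)"
    and "integrable M (\<lambda>w. \<bar>residual \<gamma> (snd w)\<bar> powr r)"
    and "(\<integral>w. \<bar>residual \<gamma> (fst w)\<bar> powr r \<partial>M) = expected_loss r \<gamma> Q"
    and "(\<integral>w. \<bar>residual \<gamma> (snd w)\<bar> powr r \<partial>M) = expected_loss r \<gamma> P"
proof -
  have [measurable_cong]: "sets M = sets borel"
    and fst: "distr M borel fst = Q" and snd: "distr M borel snd = P"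
    using assms by (auto simp: couplings_def)
  have [measurable]: "fst \<in> measurable M borel" "snd \<in> measurable M borel"
    by (auto intro!: borel_measurable_continuous_onI continuous_intros
        simp: measurable_cong_sets[OF \<open>sets M = sets borel\<close> refl])
  show "integrable M (\<lambda>w. \<bar>residual \<gamma> (fst w)\<bar> powr r)"
    using integrable_residual_powr[OF Q \<open>0 \<le> r\<close>, of \<gamma>] unfolding fst[symmetric]
    by (subst (asm) integrable_distr_eq) auto
  show "integrable M (\<lambda>w. \<bar>residual \<gamma> (snd w)\<bar> powr r)"
    using integrable_residual_powr[OF P \<open>0 \<le> r\<close>, of \<gamma>] unfolding snd[symmetric]
    by (subst (asm) integrable_distr_eq) auto
  show "(\<integral>w. \<bar>residual \<gamma> (fst w)\<bar> powr r \<partial>M) = expected_loss r \<gamma> Q"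
    unfolding expected_loss_def fst[symmetric] by (subst integral_distr) auto
  show "(\<integral>w. \<bar>residual \<gamma> (snd w)\<bar> powr r \<partial>M) = expected_loss r \<gamma> P"
    unfolding expected_loss_def snd[symmetric] by (subst integral_distr) auto
qed

text \<open>
  Under a coupling the residual of \<open>Q\<close> is the residual of \<open>P\<close> plus their difference, so
  Minkowski's inequality applies on the joint space.
\<close>

lemma expected_loss_le_of_coupling:
  assumes r: "1 \<le> r" and M: "M \<in> couplings Q P"
    and Q: "Q \<in> moment_measures r" and P: "P \<in> moment_measures r"
    and A: "0 < A" "expected_loss r \<gamma> P \<le> A powr r"
    and B: "0 < B" "(\<integral>w. \<bar>residual \<gamma> (fst w) - residual \<gamma> (snd w)\<bar> powr r \<partial>M) \<le> B powr r"
  shows "expected_loss r \<gamma> Q \<le> (A + B) powr r"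
proof -
  have sM [measurable_cong]: "sets M = sets borel"
    using M by (auto simp: couplings_def)
  have [measurable]: "fst \<in> measurable M borel" "snd \<in> measurable M borel"
    by (auto intro!: borel_measurable_continuous_onI continuous_intros
        simp: measurable_cong_sets[OF sM refl])
  have r0: "0 \<le> r"
    using r by simp
  note marg = coupling_residual_moments[OF M Q P r0, of \<gamma>]
  have "integrable M (\<lambda>w. \<bar>residual \<gamma> (fst w) + - residual \<gamma> (snd w)\<bar> powr r)"
    using marg by (intro integrable_powr_add[OF r]) auto
  then have "(\<integral>w. \<bar>residual \<gamma> (snd w) + (residual \<gamma> (fst w) - residual \<gamma> (snd w))\<bar> powr r \<partial>M)
      \<le> (A + B) powr r"
    using marg A B by (intro Minkowski_powr[OF r]) auto
  then show ?thesis
    using marg by simp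
qed

text \<open>
  The infimum over couplings need not be reached, and the loss under \<open>P\<close> may be zero. Both are
  handled by a slack \<open>e\<close>, which is sent to zero at the end.
\<close>

lemma expected_loss_le_in_ball:
  assumes r: "1 \<le> r" and s: "1 \<le> \<sigma>" and nonneg: "\<forall>x. 0 \<le> \<rho> x" and d: "0 \<le> \<delta>"
    and P: "P \<in> moment_measures r" and Q: "Q \<in> wasserstein_ball r \<rho> \<sigma> \<delta> P"
  shows "expected_loss r \<beta> Q \<le> (expected_loss r \<beta> P powr (1/r) + \<delta> * (\<sigma> + \<rho> \<beta>)) powr r"
proof -
  define A where "A = expected_loss r \<beta> P powr (1/r)"
  define K where "K = \<sigma> + \<rho> \<beta>"
  have K: "0 < K"
    using s nonneg by (simp add: K_def add_pos_nonneg)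
  have A0: "0 \<le> A"
    by (simp add: A_def)
  have Ar: "A powr r = expected_loss r \<beta> P"
    using r by (simp add: A_def powr_powr expected_loss_nonneg)
  have Q': "Q \<in> moment_measures r" "max_sliced_wasserstein r \<rho> \<sigma> Q P \<le> ereal \<delta>"
    using Q by (auto simp: wasserstein_ball_def)
  have bound: "expected_loss r \<beta> Q \<le> ((A + e) + (\<delta> + e) * K) powr r" if e: "0 < e" for e
  proof -
    let ?I = "\<lambda>M. \<integral>w. \<bar>residual \<beta> (fst w) - residual \<beta> (snd w)\<bar> powr r \<partial>M"
    have "(INF M\<in>couplings Q P. ereal (1 / K * ?I M powr (1/r))) \<le> max_sliced_wasserstein r \<rho> \<sigma> Q P"
      unfolding max_sliced_wasserstein_def K_def by (rule SUP_upper) simp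
    also have "\<dots> < ereal (\<delta> + e)"
      using Q'(2) e by (simp add: le_less_trans)
    finally obtain M where M: "M \<in> couplings Q P" and "1 / K * ?I M powr (1/r) < \<delta> + e"
      unfolding INF_less_iff by auto
    then have lt: "?I M powr (1/r) \<le> (\<delta> + e) * K"
      using K by (simp add: field_simps)
    have "?I M = (?I M powr (1/r)) powr r"
      using r by (simp add: powr_powr)
    also have "\<dots> \<le> ((\<delta> + e) * K) powr r"
      using lt r by (intro powr_mono2) auto
    finally have I: "?I M \<le> ((\<delta> + e) * K) powr r" .
    have "expected_loss r \<beta> P \<le> (A + e) powr r"
      unfolding Ar[symmetric] using r e A0 by (intro powr_mono2) auto
    then show ?thesis
      using expected_loss_le_of_coupling[OF r M Q'(1) P _ _ _ I] e A0 d K by simp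
  qed
  have "((\<lambda>e. ((A + e) + (\<delta> + e) * K) powr r) \<longlongrightarrow> ((A + 0) + (\<delta> + 0) * K) powr r) (at_right 0)"
    using r A0 d K
    by (intro tendsto_powr2 tendsto_intros eventually_at_right_less[THEN eventually_mono]) auto
  then have "expected_loss r \<beta> Q \<le> ((A + 0) + (\<delta> + 0) * K) powr r"
    using bound
    by (intro tendsto_lowerbound) (auto intro: eventually_at_right_less[THEN eventually_mono])
  then show ?thesis
    by (simp add: A_def K_def)
qed

section \<open>The worst-case distribution\<close>

text \<open>
  The residual in direction \<open>\<beta>\<close>, scaled by \<open>k\<close>, plays the part of the perturbation \<open>e\<close>. A free
  parameter \<open>k\<close>, instead of \<open>\<delta> / (E |residual \<beta>|^r)^(1/r)\<close>, makes the map independent of the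
  measure that it pushes forward.
\<close>

definition residual_push ::
  "real \<Rightarrow> real \<Rightarrow> real^'n \<Rightarrow> real^'n \<Rightarrow> ('n::finite) data \<Rightarrow> 'n data" where
  "residual_push k \<sigma> \<beta> v z =
     (fst z - (k * residual \<beta> z) *\<^sub>R v, snd z + \<sigma> * (k * residual \<beta> z))"

lemma residual_residual_push:
  "residual \<gamma> (residual_push k \<sigma> \<beta> v z) = residual \<gamma> z + k * residual \<beta> z * (\<sigma> + \<gamma> \<bullet> v)"
  unfolding residual_push_def residual_def[of \<gamma>]
  by (simp add: inner_diff_left inner_commute algebra_simps)

lemma linear_residual_push: "linear (residual_push k \<sigma> \<beta> v)"
  by (rule linearI)
    (simp_all add: residual_push_def linear_add[OF linear_residual] linear_cmul[OF linear_residual]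
      algebra_simps)

lemma distr_linear_moment_measures:
  fixes P :: "'n::finite data measure" and T :: "'n data \<Rightarrow> 'n data"
  assumes P: "P \<in> moment_measures r" and "0 \<le> r" and T: "linear T"
  shows "distr P borel T \<in> moment_measures r"
proof -
  note PD = moment_measuresD[OF P]
  have Tm: "T \<in> measurable P borel"
    unfolding measurable_cong_sets[OF PD(2) refl] by (rule borel_measurable_linear[OF T])
  show ?thesis
    using integrable_linear_powr[OF assms] prob_space.prob_space_distr[OF PD(1) Tm]
    by (simp add: moment_measures_def integrable_distr_eq[OF Tm])
qed

text \<open>
  This coupling is what bounds the infimum in the max-sliced distance from above, in all
  directions at once.
\<close>

lemma graph_coupling:
  fixes P :: "'n::finite data measure" and T :: "'n data \<Rightarrow> 'n data"
  assumes "prob_space P" and sP [measurable_cong]: "sets P = sets borel"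
    and [measurable]: "T \<in> borel_measurable borel"
  shows "distr P borel (\<lambda>z. (T z, z)) \<in> couplings (distr P borel T) P"
proof -
  have m: "(\<lambda>z. (T z, z)) \<in> measurable P borel"
    by (intro borel_measurable_Pair) measurable
  have p: "(fst :: 'n data \<times> 'n data \<Rightarrow> 'n data) \<in> measurable borel borel"
      "(snd :: 'n data \<times> 'n data \<Rightarrow> 'n data) \<in> measurable borel borel"
    by (auto intro!: borel_measurable_continuous_onI continuous_intros)
  show ?thesis
    using prob_space.prob_space_distr[OF assms(1) m]
    by (simp add: couplings_def distr_distr[OF p(1) m] distr_distr[OF p(2) m] comp_def
        distr_id2[OF sP[symmetric]])
qed

text \<open>
  In direction \<open>\<gamma>\<close> the graph coupling changes the residual by
  \<open>k (\<sigma> + \<gamma> \<bullet> v)\<close> times the residual in direction \<open>\<beta>\<close>. The bound on \<open>\<gamma> \<bullet> v\<close> makes the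
  first factor at most \<open>k (\<sigma> + \<rho> \<gamma>)\<close>, and the normalisation by \<open>\<sigma> + \<rho> \<gamma>\<close> removes the
  dependence on \<open>\<gamma>\<close>.
\<close>

lemma max_sliced_wasserstein_push_le:
  fixes P :: "'n::finite data measure" and \<beta> v :: "real^'n" and k \<sigma> :: real
  defines "T \<equiv> residual_push k \<sigma> \<beta> v"
  assumes r: "1 \<le> r" and s: "1 \<le> \<sigma>" and nonneg: "\<forall>x. 0 \<le> \<rho> x" and k: "0 \<le> k"
    and P: "P \<in> moment_measures r" and v: "\<And>\<gamma>. \<bar>\<gamma> \<bullet> v\<bar> \<le> \<rho> \<gamma>"
  shows "max_sliced_wasserstein r \<rho> \<sigma> (distr P borel T) P
     \<le> ereal (k * expected_loss r \<beta> P powr (1/r))"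
  unfolding max_sliced_wasserstein_def
proof (rule SUP_least)
  fix \<gamma> :: "real^'n"
  note PD = moment_measuresD[OF P]
  note [measurable_cong] = PD(2)
  have [measurable]: "T \<in> borel_measurable borel"
    unfolding T_def by (rule borel_measurable_linear[OF linear_residual_push])
  have m: "(\<lambda>z. (T z, z)) \<in> measurable P borel"
    by (intro borel_measurable_Pair) measurable
  let ?M = "distr P borel (\<lambda>z. (T z, z))"
  let ?c = "k * \<bar>\<sigma> + \<gamma> \<bullet> v\<bar>"
  have [measurable]: "(fst :: 'n data \<times> 'n data \<Rightarrow> 'n data) \<in> measurable borel borel"
      "(snd :: 'n data \<times> 'n data \<Rightarrow> 'n data) \<in> measurable borel borel"
    by (auto intro!: borel_measurable_continuous_onI continuous_intros)
  have pm: "(\<lambda>w::'n data \<times> 'n data. \<bar>residual \<gamma> (fst w) - residual \<gamma> (snd w)\<bar> powr r) \<in> borel_measurable borel"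
    by measurable
  have "(\<integral>w. \<bar>residual \<gamma> (fst w) - residual \<gamma> (snd w)\<bar> powr r \<partial>?M)
      = (\<integral>z. \<bar>residual \<gamma> (T z) - residual \<gamma> z\<bar> powr r \<partial>P)"
    by (simp add: integral_distr[OF m pm])
  also have "\<dots> = (\<integral>z. ?c powr r * \<bar>residual \<beta> z\<bar> powr r \<partial>P)"
    unfolding T_def residual_residual_push using k
    by (simp add: abs_mult powr_mult mult_ac)
  also have "\<dots> = ?c powr r * expected_loss r \<beta> P"
    by (simp add: expected_loss_def)
  finally have I: "(\<integral>w. \<bar>residual \<gamma> (fst w) - residual \<gamma> (snd w)\<bar> powr r \<partial>?M) powr (1/r)
      = ?c * expected_loss r \<beta> P powr (1/r)"
    using r k by (simp add: powr_mult powr_powr)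
  have K: "0 < \<sigma> + \<rho> \<gamma>"
    using s nonneg by (simp add: add_pos_nonneg)
  have "\<bar>\<sigma> + \<gamma> \<bullet> v\<bar> \<le> \<sigma> + \<rho> \<gamma>"
    using v[of \<gamma>] s by linarith
  then have "1 / (\<sigma> + \<rho> \<gamma>) * (?c * expected_loss r \<beta> P powr (1/r))
      \<le> 1 / (\<sigma> + \<rho> \<gamma>) * (k * (\<sigma> + \<rho> \<gamma>) * expected_loss r \<beta> P powr (1/r))"
    using K k by (intro mult_left_mono mult_right_mono) auto
  also have "\<dots> = k * expected_loss r \<beta> P powr (1/r)"
    using K by simp
  finally show "(INF M\<in>couplings (distr P borel T) P. ereal (1 / (\<sigma> + \<rho> \<gamma>) *
      (\<integral>w. \<bar>residual \<gamma> (fst w) - residual \<gamma> (snd w)\<bar> powr r \<partial>M) powr (1 / r)))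
    \<le> ereal (k * expected_loss r \<beta> P powr (1/r))"
    unfolding I[symmetric]
    by (intro INF_lower2[OF graph_coupling[OF PD(1,2)]]) auto
qed

text \<open>
  In direction \<open>\<beta>\<close> the map multiplies the residual by the nonnegative constant
  \<open>1 + k (\<sigma> + \<beta> \<bullet> v)\<close>, so the \<open>L^r\<close> norms of the residual and of its change simply add.
\<close>

lemma expected_loss_push:
  fixes P :: "'n::finite data measure" and \<beta> v :: "real^'n" and k \<sigma> :: real
  defines "T \<equiv> residual_push k \<sigma> \<beta> v"
  assumes r: "1 \<le> r" and P: "P \<in> moment_measures r" and nonneg: "0 \<le> k * (\<sigma> + \<beta> \<bullet> v)"
  shows "expected_loss r \<beta> (distr P borel T)
     = (expected_loss r \<beta> P powr (1/r) + k * expected_loss r \<beta> P powr (1/r) * (\<sigma> + \<beta> \<bullet> v)) powr r"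
proof -
  let ?c = "1 + k * (\<sigma> + \<beta> \<bullet> v)"
  note PD = moment_measuresD[OF P]
  have T: "T \<in> measurable P borel"
    unfolding T_def measurable_cong_sets[OF PD(2) refl]
    by (rule borel_measurable_linear[OF linear_residual_push])
  have "expected_loss r \<beta> (distr P borel T) = (\<integral>z. \<bar>residual \<beta> (T z)\<bar> powr r \<partial>P)"
    unfolding expected_loss_def by (rule integral_distr[OF T]) measurable
  also have "\<dots> = (\<integral>z. ?c powr r * \<bar>residual \<beta> z\<bar> powr r \<partial>P)"
  proof (rule Bochner_Integration.integral_cong[OF refl])
    fix z
    have "residual \<beta> (T z) = ?c * residual \<beta> z"
      unfolding T_def residual_residual_push by (simp add: algebra_simps)
    then show "\<bar>residual \<beta> (T z)\<bar> powr r = ?c powr r * \<bar>residual \<beta> z\<bar> powr r"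
      using nonneg by (simp add: abs_mult powr_mult)
  qed
  also have "\<dots> = ?c powr r * expected_loss r \<beta> P"
    by (simp add: expected_loss_def)
  also have "\<dots> = ?c powr r * (expected_loss r \<beta> P powr (1/r)) powr r"
    using r by (simp add: powr_powr expected_loss_nonneg)
  also have "\<dots> = (?c * expected_loss r \<beta> P powr (1/r)) powr r"
    by (rule powr_mult[symmetric])
  finally show ?thesis
    by (simp add: algebra_simps)
qed

theorem corollary1:
  fixes \<rho> :: "real^'n::finite \<Rightarrow> real"
    and r \<sigma> \<delta> :: real
    and P :: "'n data measure"
    and \<beta> \<beta>s :: "real^'n"
  assumes "1 \<le> r" and "1 \<le> \<sigma>"
    and "convex_on UNIV \<rho>" and "\<forall>x. 0 \<le> \<rho> x"
    and "\<forall>\<beta>'. \<exists>b. admissible_subgradient \<rho> \<beta>' b"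
    and "0 \<le> \<delta>" and "P \<in> moment_measures r"
    and "\<delta> = 0 \<or> expected_loss r \<beta> P \<noteq> 0"
    and "admissible_subgradient \<rho> \<beta> \<beta>s"
  shows "worst_case_distribution r \<rho> \<sigma> \<delta> \<beta> \<beta>s P \<in> wasserstein_ball r \<rho> \<sigma> \<delta> P \<and>
    (SUP Q\<in>wasserstein_ball r \<rho> \<sigma> \<delta> P. ereal (expected_loss r \<beta> Q)) =
      ereal (expected_loss r \<beta> (worst_case_distribution r \<rho> \<sigma> \<delta> \<beta> \<beta>s P))"
proof -
  define v where "v = shift_direction \<rho> \<beta> \<beta>s"
  define A where "A = expected_loss r \<beta> P powr (1/r)"
  define k where "k = \<delta> / A"
  define T where "T = residual_push k \<sigma> \<beta> v"
  let ?W = "worst_case_distribution r \<rho> \<sigma> \<delta> \<beta> \<beta>s P"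
  have W: "?W = distr P borel T"
    by (simp add: worst_case_distribution_def perturbation_def T_def residual_push_def[abs_def]
        v_def k_def A_def)
  \<comment> \<open>If \<open>A = 0\<close>, then \<open>\<delta> = 0\<close> and \<open>k = 0\<close> by division by zero, so both cases of the
    hypothesis are treated alike from here on.\<close>
  have kA: "k * A = \<delta>"
    using assms(8) by (auto simp: k_def A_def)
  have k: "0 \<le> k"
    using assms(6) by (simp add: k_def A_def)
  have \<beta>v: "\<beta> \<bullet> v = \<rho> \<beta>"
    using inner_shift_direction[OF assms(3-5)] assms(9)
    by (simp add: v_def admissible_subgradient_def)
  have v: "\<bar>\<gamma> \<bullet> v\<bar> \<le> \<rho> \<gamma>" for \<gamma>
    using assms(9) by (simp add: v_def admissible_subgradient_def)
  have ball: "?W \<in> wasserstein_ball r \<rho> \<sigma> \<delta> P"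
    using distr_linear_moment_measures[OF assms(7) _ linear_residual_push[of k \<sigma> \<beta> v]]
      max_sliced_wasserstein_push_le[OF assms(1,2,4) k assms(7) v, of \<beta>] assms(1)
    by (simp add: wasserstein_ball_def W T_def kA A_def[symmetric])
  have loss: "expected_loss r \<beta> ?W = (A + \<delta> * (\<sigma> + \<rho> \<beta>)) powr r"
    using expected_loss_push[OF assms(1,7), of k \<sigma> \<beta> v] assms(2,4) k
    by (simp add: W T_def A_def[symmetric] kA \<beta>v)
  have "(SUP Q\<in>wasserstein_ball r \<rho> \<sigma> \<delta> P. ereal (expected_loss r \<beta> Q)) = ereal (expected_loss r \<beta> ?W)"
  proof (rule antisym)
    show "(SUP Q\<in>wasserstein_ball r \<rho> \<sigma> \<delta> P. ereal (expected_loss r \<beta> Q)) \<le> ereal (expected_loss r \<beta> ?W)"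
      unfolding loss A_def
      by (intro SUP_least) (simp add: expected_loss_le_in_ball[OF assms(1,2,4,6,7)])
  qed (rule SUP_upper[OF ball])
  with ball show ?thesis ..
qed

end
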